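(* No rational in $(0,1)$ is realizable for any graph $H$. Moreover, $0$ is realizable for every graph $H$ without isolated vertices, and $1$ is realizable for every connected graph $H$.
   Context: Graphs are finite and simple; $v(H)$ denotes the number of vertices of $H$. A graph is $\mathcal{F}$-free, for a family of graphs $\mathcal{F}$, if it contains no (not necessarily induced) subgraph isomorphic to a member of $\mathcal{F}$. $\mathrm{ex}(n,H,\mathcal{F})$ is the maximum number of copies of $H$ (subgraphs isomorphic to $H$) that an $n$-vertex $\mathcal{F}$-free graph can have, with the convention that it is $0$ if there is no $\mathcal{F}$-free graph on $n$ vertices. A rational number $r\in[0,v(H)]$ is realizable for $H$ if there exists a finite family of graphs $\mathcal{F}$ such that $\mathrm{ex}(n,H,\mathcal{F})=\Theta(n^r)$ as $n\to\infty$. *)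

theory Defs
  imports Complex_Main "HOL-Library.Landau_Symbols" "Graph_Theory.Graph_Theory"
begin

text \<open>
  A finite simple graph is a \<^locale>\<open>pair_graph\<close>: a finite vertex set together with a finite,
  symmetric, irreflexive set of ordered pairs of vertices, each undirected edge being
  represented by its two orientations. The null graph is a graph, but it is not connected.

  Graphs whose number of copies is counted, as well as the forbidden graphs, have vertices
  of type \<^typ>\<open>nat\<close>; every finite graph is isomorphic to such a graph.
\<close>

definition copies :: "'a pair_pre_digraph \<Rightarrow> 'b pair_pre_digraph \<Rightarrow> 'b pair_pre_digraph set" where
  "copies H G = {K. pair_graph K \<and> subgraph (with_proj K) (with_proj G)
                    \<and> digraph_iso (with_proj K) (with_proj H)}"

definition family_free :: "'a pair_pre_digraph set \<Rightarrow> 'b pair_pre_digraph \<Rightarrow> bool" where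
  "family_free \<F> G \<longleftrightarrow> (\<forall>F\<in>\<F>. copies F G = {})"

definition free_graphs :: "nat \<Rightarrow> nat pair_pre_digraph set \<Rightarrow> nat pair_pre_digraph set" where
  "free_graphs n \<F> = {G. pair_graph G \<and> card (pverts G) = n \<and> family_free \<F> G}"

definition ex_number :: "nat \<Rightarrow> 'a pair_pre_digraph \<Rightarrow> nat pair_pre_digraph set \<Rightarrow> nat" where
  "ex_number n H \<F> =
     (if free_graphs n \<F> = {} then 0 else Max ((\<lambda>G. card (copies H G)) ` free_graphs n \<F>))"

definition realizable :: "'a pair_pre_digraph \<Rightarrow> rat \<Rightarrow> bool" where
  "realizable H r \<longleftrightarrow> 0 \<le> r \<and> r \<le> of_nat (card (pverts H)) \<and>
     (\<exists>\<F>. finite \<F> \<and> (\<forall>F\<in>\<F>. pair_graph F) \<and>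
        (\<lambda>n. real (ex_number n H \<F>)) \<in> \<Theta>(\<lambda>n. real n powr real_of_rat r))"

definition isolated_vertex :: "'a pair_pre_digraph \<Rightarrow> 'a \<Rightarrow> bool" where
  "isolated_vertex H v \<longleftrightarrow> v \<in> pverts H \<and> (\<forall>w. (v, w) \<notin> parcs H)"

text \<open>The maximum in \<open>ex_number\<close> is taken over a finite set, and each set of copies is finite,
  so neither \<open>Max\<close> nor \<open>card\<close> takes a default value.\<close>

lemma pair_pre_digraph_subset_bound:
  fixes V :: "'b set"
  assumes "finite V" "finite A"
  shows "finite {K :: 'b pair_pre_digraph. pverts K \<subseteq> V \<and> parcs K \<subseteq> A}"
    and "card {K :: 'b pair_pre_digraph. pverts K \<subseteq> V \<and> parcs K \<subseteq> A} \<le> 2 ^ card V * 2 ^ card A"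
proof -
  let ?f = "\<lambda>(v, a). \<lparr>pverts = v, parcs = a\<rparr> :: 'b pair_pre_digraph"
  have eq: "{K :: 'b pair_pre_digraph. pverts K \<subseteq> V \<and> parcs K \<subseteq> A} \<subseteq> ?f ` (Pow V \<times> Pow A)"
  proof
    fix K :: "'b pair_pre_digraph"
    assume "K \<in> {K. pverts K \<subseteq> V \<and> parcs K \<subseteq> A}"
    then have "K = ?f (pverts K, parcs K)" "(pverts K, parcs K) \<in> Pow V \<times> Pow A" by auto
    then show "K \<in> ?f ` (Pow V \<times> Pow A)" by (rule image_eqI)
  qed
  have fin: "finite (Pow V \<times> Pow A)" using assms by simp
  show "finite {K :: 'b pair_pre_digraph. pverts K \<subseteq> V \<and> parcs K \<subseteq> A}"
    using eq fin by (meson finite_imageI finite_subset)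
  have "card {K :: 'b pair_pre_digraph. pverts K \<subseteq> V \<and> parcs K \<subseteq> A} \<le> card (Pow V \<times> Pow A)"
    using eq fin by (rule surj_card_le[rotated])
  then show "card {K :: 'b pair_pre_digraph. pverts K \<subseteq> V \<and> parcs K \<subseteq> A} \<le> 2 ^ card V * 2 ^ card A"
    using assms by (simp add: card_cartesian_product card_Pow)
qed

lemma copies_subset: "copies H G \<subseteq> {K. pverts K \<subseteq> pverts G \<and> parcs K \<subseteq> parcs G}"
  by (auto simp: copies_def subgraph_def)

lemma finite_copies:
  assumes "pair_graph G"
  shows "finite (copies H G)"
proof -
  interpret pair_graph G by (rule assms)
  show ?thesis
    using copies_subset pair_pre_digraph_subset_bound(1)[OF pair_finite_verts pair_finite_arcs]
    by (rule finite_subset)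
qed

lemma finite_copy_counts: "finite ((\<lambda>G. card (copies H G)) ` free_graphs n \<F>)"
proof (rule finite_subset)
  show "(\<lambda>G. card (copies H G)) ` free_graphs n \<F> \<subseteq> {..2 ^ n * 2 ^ (n * n)}"
  proof (rule image_subsetI)
    fix G assume "G \<in> free_graphs n \<F>"
    then have G: "pair_graph G" "card (pverts G) = n" by (auto simp: free_graphs_def)
    interpret pair_graph G by (rule G)
    have "parcs G \<subseteq> pverts G \<times> pverts G" using wellformed' by auto
    then have a: "card (parcs G) \<le> n * n"
      using card_mono[of "pverts G \<times> pverts G" "parcs G"] pair_finite_verts G(2)
      by (simp add: card_cartesian_product)
    have "card (copies H G) \<le> 2 ^ card (pverts G) * 2 ^ card (parcs G)"
      by (rule order_trans[OF
            card_mono[OF pair_pre_digraph_subset_bound(1)[OF pair_finite_verts pair_finite_arcs]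
              copies_subset]
            pair_pre_digraph_subset_bound(2)[OF pair_finite_verts pair_finite_arcs]])
    also have "\<dots> \<le> 2 ^ n * 2 ^ (n * n)" using a G(2) by (simp add: power_increasing)
    finally show "card (copies H G) \<in> {..2 ^ n * 2 ^ (n * n)}" by simp
  qed
qed simp

end

theory Submission
  imports Defs
begin

text \<open>
  Forbid all graphs on at most \<open>2 v(H)\<close> vertices that contain two distinct copies of \<open>H\<close>: then
  every graph has at most one copy, and \<open>H\<close> with isolated vertices added has one. Forbidding only
  pairs of distinct copies that share a vertex leaves at most \<open>n\<close> copies, and disjoint unions of a
  connected \<open>H\<close> are still allowed.

  For an exponent in \<open>(0,1)\<close> the number of copies is unbounded, so a sunflower argument yields an
  \<open>\<F>\<close>-free graph consisting of \<open>m\<close> copies of \<open>H\<close> that agree on a proper subset \<open>D\<close> of the vertices and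
  are disjoint elsewhere, with \<open>m\<close> at least the order of every forbidden graph. Such a sunflower remains
  \<open>\<F>\<close>-free when further petals are added, so linearly many copies occur for infinitely many \<open>n\<close>.
\<close>

section \<open>Embeddings, images and copies\<close>

text \<open>Only the values of \<open>f\<close> on \<open>pverts F\<close> matter, and embeddings
  that differ by an automorphism of \<open>F\<close> have the same image. Copies are therefore
  counted as images \<open>gimage f F\<close>, not as embeddings.\<close>

definition emb :: "('a \<Rightarrow> 'b) \<Rightarrow> 'a pair_pre_digraph \<Rightarrow> 'b pair_pre_digraph \<Rightarrow> bool" where
  "emb f F G \<longleftrightarrow> inj_on f (pverts F) \<and> f ` pverts F \<subseteq> pverts G \<and> map_prod f f ` parcs F \<subseteq> parcs G"

definition gimage :: "('a \<Rightarrow> 'b) \<Rightarrow> 'a pair_pre_digraph \<Rightarrow> 'b pair_pre_digraph" where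
  "gimage f F = \<lparr>pverts = f ` pverts F, parcs = map_prod f f ` parcs F\<rparr>"

lemma gimage_simps [simp]:
  "pverts (gimage f F) = f ` pverts F" "parcs (gimage f F) = map_prod f f ` parcs F"
  by (simp_all add: gimage_def)

lemma pair_pre_digraph_eqI:
  "pverts G = pverts K \<Longrightarrow> parcs G = parcs K \<Longrightarrow> G = (K :: 'a pair_pre_digraph)"
  by simp

lemma gimage_eq_iff:
  "gimage f F = gimage g F \<longleftrightarrow>
    f ` pverts F = g ` pverts F \<and> map_prod f f ` parcs F = map_prod g g ` parcs F"
  by (simp add: gimage_def)

lemma gimage_comp: "gimage (g \<circ> f) F = gimage g (gimage f F)"
  by (simp add: gimage_def image_comp map_prod_compose)

text \<open>With relations in place of the locale, images and unions of graphs can be treated by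
  facts about \<open>sym\<close> and \<open>irrefl\<close>.\<close>

lemma pair_graph_iff:
  "pair_graph G \<longleftrightarrow> finite (pverts G) \<and> parcs G \<subseteq> pverts G \<times> pverts G \<and> sym (parcs G) \<and> irrefl (parcs G)"
proof
  assume "pair_graph G"
  then interpret pair_graph G .
  show "finite (pverts G) \<and> parcs G \<subseteq> pverts G \<times> pverts G \<and> sym (parcs G) \<and> irrefl (parcs G)"
    using pair_finite_verts wellformed' pair_sym_arcs
    by (auto simp: symmetric_def irrefl_def dest: pair_no_loops)
next
  assume G: "finite (pverts G) \<and> parcs G \<subseteq> pverts G \<times> pverts G \<and> sym (parcs G) \<and> irrefl (parcs G)"
  then have "finite (parcs G)" by (meson finite_SigmaI finite_subset)
  with G show "pair_graph G"
    by unfold_locales (auto simp: symmetric_def irrefl_def)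
qed

lemma
  assumes "pair_graph G"
  shows pair_graph_finite_verts: "finite (pverts G)"
    and pair_graph_finite_arcs: "finite (parcs G)"
    and pair_graph_arcs_subset: "parcs G \<subseteq> pverts G \<times> pverts G"
  using assms by (auto simp: pair_graph_iff intro: finite_subset[OF _ finite_SigmaI])

lemma inj_on_map_prod_arcs:
  assumes "pair_graph G" "inj_on f (pverts G)"
  shows "inj_on (map_prod f f) (parcs G)"
  by (rule inj_on_subset[OF map_prod_inj_on[OF assms(2,2)] pair_graph_arcs_subset[OF assms(1)]])

lemma pair_graph_gimage:
  assumes "pair_graph G" "inj_on f (pverts G)"
  shows "pair_graph (gimage f G)"
proof -
  have "sym (map_prod f f ` parcs G)"
    using assms(1) by (fastforce simp: pair_graph_iff sym_def)
  moreover have "irrefl (map_prod f f ` parcs G)"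
    using assms by (auto simp: pair_graph_iff irrefl_def dest!: inj_onD)
  ultimately show ?thesis
    using assms(1) by (auto simp: pair_graph_iff)
qed

lemma emb_inj: "emb f F G \<Longrightarrow> inj_on f (pverts F)"
  by (auto simp: emb_def)

lemma emb_comp:
  assumes "emb f F G" "emb g G K"
  shows "emb (g \<circ> f) F K"
proof -
  have "inj_on (g \<circ> f) (pverts F)"
    using assms by (auto simp: emb_def intro: comp_inj_on inj_on_subset)
  moreover have "(g \<circ> f) ` pverts F \<subseteq> pverts K"
    using assms by (auto simp: emb_def image_subset_iff)
  moreover have "map_prod (g \<circ> f) (g \<circ> f) ` parcs F = map_prod g g ` map_prod f f ` parcs F"
    by (simp add: image_comp map_prod_compose)
  ultimately show ?thesis
    using assms unfolding emb_def by (metis image_mono subset_trans)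
qed

lemma emb_gimage: "inj_on f (pverts F) \<Longrightarrow> emb f F (gimage f F)"
  by (simp add: emb_def)

lemma emb_inv_gimage:
  assumes "pair_graph F" "inj_on f (pverts F)"
  shows "emb (the_inv_into (pverts F) f) (gimage f F) F"
  using pair_graph_arcs_subset[OF assms(1)] assms(2)
  by (auto simp: emb_def inj_on_the_inv_into the_inv_into_f_f)

lemma digraph_iso_gimageI:
  assumes "pair_graph F" "inj_on f (pverts F)"
  shows "digraph_iso (with_proj F) (with_proj (gimage f F))"
  unfolding digraph_iso_def
proof (intro exI conjI)
  let ?h = "\<lparr>iso_verts = f, iso_arcs = map_prod f f, iso_head = snd, iso_tail = fst\<rparr>"
  interpret pair_graph F by (rule assms)
  show "pre_digraph.digraph_isomorphism (with_proj F) ?h"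
    using assms(2) inj_on_map_prod_arcs[OF assms] wf_digraph
    by (simp add: pre_digraph.digraph_isomorphism_def)
  show "with_proj (gimage f F) = app_iso ?h (with_proj F)"
    by (simp add: app_iso_def with_proj_def)
qed

text \<open>In \<open>with_proj\<close> an arc is the pair of its ends, on both sides, so the arc
  part of an isomorphism is forced by its vertex part.\<close>

lemma digraph_iso_gimageE:
  assumes "digraph_iso (with_proj K) (with_proj H)"
  obtains f where "inj_on f (pverts K)" "H = gimage f K"
proof -
  obtain h where h: "pre_digraph.digraph_isomorphism (with_proj K) h"
    and H: "with_proj H = app_iso h (with_proj K)"
    using assms by (auto simp: digraph_iso_def)
  have ht: "iso_tail h = fst" "iso_head h = snd"
    and v: "pverts H = iso_verts h ` pverts K" and a: "parcs H = iso_arcs h ` parcs K"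
    using H by (simp_all add: app_iso_def with_proj_def)
  have "iso_arcs h e = map_prod (iso_verts h) (iso_verts h) e" if "e \<in> parcs K" for e
    using h that ht by (auto simp: pre_digraph.digraph_isomorphism_def prod_eq_iff)
  then have "H = gimage (iso_verts h) K"
    using v a by (intro pair_pre_digraph_eqI) (auto intro: image_cong)
  with h show thesis
    by (intro that) (auto simp: pre_digraph.digraph_isomorphism_def)
qed

text \<open>Bridge from isomorphic subgraphs to embeddings: the inverse of an isomorphism from
  \<open>K\<close> to \<open>H\<close> embeds \<open>H\<close> in \<open>G\<close> with image
  \<open>K\<close>, and the inverse of an embedding carries its image back onto
  \<open>H\<close>.\<close>

lemma copies_eq_gimage:
  assumes "pair_graph H" "pair_graph G"
  shows "copies H G = {gimage f H | f. emb f H G}"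
proof (intro equalityI subsetI)
  fix K assume "K \<in> copies H G"
  then have K: "pair_graph K" "pverts K \<subseteq> pverts G" "parcs K \<subseteq> parcs G"
    and "digraph_iso (with_proj K) (with_proj H)"
    by (auto simp: copies_def subgraph_def)
  then obtain f where f: "inj_on f (pverts K)" "H = gimage f K"
    by (elim digraph_iso_gimageE)
  let ?g = "the_inv_into (pverts K) f"
  have "?g ` pverts H = pverts K"
    using f by (auto simp: the_inv_into_f_f image_iff)
  moreover have "map_prod ?g ?g ` parcs H = parcs K"
  proof -
    have "map_prod ?g ?g ` parcs H = (\<lambda>e. e) ` parcs K"
      unfolding f(2) gimage_simps image_image
      using pair_graph_arcs_subset[OF K(1)] f(1)
      by (intro image_cong) (auto simp: the_inv_into_f_f)
    then show ?thesis by simp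
  qed
  moreover have "emb ?g H K"
    using emb_inv_gimage[OF K(1) f(1)] f(2) by simp
  ultimately have "K = gimage ?g H" "emb ?g H G"
    using K by (auto simp: emb_def)
  then show "K \<in> {gimage f H | f. emb f H G}" by blast
next
  fix K assume "K \<in> {gimage f H | f. emb f H G}"
  then obtain f where f: "emb f H G" and K: "K = gimage f H" by blast
  have inj: "inj_on f (pverts H)" using f by (simp add: emb_def)
  have pK: "pair_graph K" using pair_graph_gimage[OF assms(1) inj] K by simp
  interpret K: pair_graph K by (rule pK)
  interpret G: pair_graph G by (rule assms(2))
  have "H = gimage (the_inv_into (pverts H) f) K"
  proof (rule pair_pre_digraph_eqI)
    let ?g = "the_inv_into (pverts H) f"
    show "pverts H = pverts (gimage ?g K)"
      using inj K by (auto simp: the_inv_into_f_f image_iff)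
    have "map_prod ?g ?g ` parcs K = (\<lambda>e. e) ` parcs H"
      unfolding K gimage_simps image_image
      using pair_graph_arcs_subset[OF assms(1)] inj
      by (intro image_cong) (auto simp: the_inv_into_f_f)
    then show "parcs H = parcs (gimage ?g K)" by simp
  qed
  moreover have "inj_on (the_inv_into (pverts H) f) (pverts K)"
    using inj K by (simp add: inj_on_the_inv_into)
  ultimately have "digraph_iso (with_proj K) (with_proj H)"
    using digraph_iso_gimageI[OF pK] by metis
  moreover have "subgraph (with_proj K) (with_proj G)"
    using f K G.wf_digraph K.wf_digraph by (auto simp: subgraph_def emb_def)
  ultimately show "K \<in> copies H G" using pK by (simp add: copies_def)
qed

lemma family_free_iff_no_emb:
  assumes "\<forall>F\<in>\<F>. pair_graph F" "pair_graph G"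
  shows "family_free \<F> G \<longleftrightarrow> (\<forall>F\<in>\<F>. \<forall>f. \<not> emb f F G)"
  using assms by (auto simp: family_free_def copies_eq_gimage)

lemma emb_family_free:
  assumes "\<forall>F\<in>\<F>. pair_graph F" "pair_graph G" "pair_graph K" "emb h G K" "family_free \<F> K"
  shows "family_free \<F> G"
  using assms emb_comp by (metis family_free_iff_no_emb)

lemma gimage_copies:
  assumes "pair_graph H" "pair_graph G" "pair_graph K" "emb h G K"
  shows "gimage h ` copies H G \<subseteq> copies H K"
  using assms emb_comp by (fastforce simp: copies_eq_gimage simp flip: gimage_comp)

lemma inj_on_gimage_copies:
  assumes "pair_graph G" "inj_on h (pverts G)"
  shows "inj_on (gimage h) (copies H G)"
proof (rule inj_onI)
  fix A B assume AB: "A \<in> copies H G" "B \<in> copies H G" "gimage h A = gimage h B"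
  then have s: "pverts A \<subseteq> pverts G" "pverts B \<subseteq> pverts G" "parcs A \<subseteq> parcs G" "parcs B \<subseteq> parcs G"
    using copies_subset by blast+
  have "h ` pverts A = h ` pverts B" "map_prod h h ` parcs A = map_prod h h ` parcs B"
    using AB(3) by (simp_all add: gimage_def)
  then show "A = B"
    using s assms(2) inj_on_map_prod_arcs[OF assms]
    by (intro pair_pre_digraph_eqI) (metis inj_on_image_eq_iff)+
qed

lemma card_copies_le_emb:
  assumes "pair_graph H" "pair_graph G" "pair_graph K" "emb h G K"
  shows "card (copies H G) \<le> card (copies H K)"
  by (rule card_inj_on_le[OF inj_on_gimage_copies[OF assms(2) emb_inj[OF assms(4)]]
        gimage_copies[OF assms] finite_copies[OF assms(3)]])

section \<open>Bounds for the extremal number\<close>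

text \<open>The maximum ranges over graphs on \<open>nat\<close>, so \<open>G\<close> is first
  relabelled injectively. Lower bounds can then come from constructions on any convenient vertex
  type.\<close>

lemma card_copies_le_ex_number:
  assumes "\<forall>F\<in>\<F>. pair_graph F" "pair_graph H" "pair_graph G" "family_free \<F> G"
  shows "card (copies H G) \<le> ex_number (card (pverts G)) H \<F>"
proof -
  obtain h :: "'b \<Rightarrow> nat" where h: "inj_on h (pverts G)"
    using finite_imp_inj_to_nat_seg[OF pair_graph_finite_verts[OF assms(3)]] by blast
  let ?K = "gimage h G"
  have K: "pair_graph ?K" by (rule pair_graph_gimage[OF assms(3) h])
  have "?K \<in> free_graphs (card (pverts G)) \<F>"
    using K emb_family_free[OF assms(1) K assms(3) emb_inv_gimage[OF assms(3) h] assms(4)]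
    by (simp add: free_graphs_def card_image[OF h])
  then have "card (copies H ?K) \<le> ex_number (card (pverts G)) H \<F>"
    unfolding ex_number_def by (auto intro!: Max_ge[OF finite_copy_counts])
  moreover have "card (copies H G) \<le> card (copies H ?K)"
    by (rule card_copies_le_emb[OF assms(2,3) K emb_gimage[OF h]])
  ultimately show ?thesis by simp
qed

lemma ex_number_le:
  assumes "\<And>G. G \<in> free_graphs n \<F> \<Longrightarrow> card (copies H G) \<le> c"
  shows "ex_number n H \<F> \<le> c"
  using assms finite_copy_counts[of H n \<F>] by (auto simp: ex_number_def)

text \<open>The strict inequality rules out the default value \<open>0\<close>, so the maximum is
  over a nonempty set.\<close>

lemma less_ex_numberE:
  assumes "c < ex_number n H \<F>"
  obtains G where "G \<in> free_graphs n \<F>" "c < card (copies H G)"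
  using assms finite_copy_counts[of H n \<F>] by (auto simp: ex_number_def Max_gr_iff split: if_splits)

section \<open>Forbidding clashing copies\<close>

text \<open>The flag merges two conditions: with \<open>c\<close> false there is at most one copy,
  with \<open>c\<close> true distinct copies are vertex-disjoint. They serve the exponents 0 and
  1.\<close>

definition scattered :: "bool \<Rightarrow> 'a pair_pre_digraph \<Rightarrow> 'b pair_pre_digraph \<Rightarrow> bool" where
  "scattered c H G \<longleftrightarrow>
    (\<forall>K\<in>copies H G. \<forall>L\<in>copies H G. K \<noteq> L \<longrightarrow> c \<and> pverts K \<inter> pverts L = {})"

text \<open>Two copies span at most \<open>2 * card (pverts H)\<close> vertices, so the size bound
  loses no obstruction. Taking the vertices from an initial segment of \<open>nat\<close> makes the
  family finite.\<close>

definition clash_family :: "bool \<Rightarrow> 'a pair_pre_digraph \<Rightarrow> nat pair_pre_digraph set" where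
  "clash_family c H =
    {F. pair_graph F \<and> pverts F \<subseteq> {..<2 * card (pverts H)} \<and> \<not> scattered c H F}"

lemma finite_clash_family: "finite (clash_family c H)"
proof (rule finite_subset[OF _ pair_pre_digraph_subset_bound(1)])
  let ?V = "{..<2 * card (pverts H)}"
  show "clash_family c H \<subseteq> {F. pverts F \<subseteq> ?V \<and> parcs F \<subseteq> ?V \<times> ?V}"
    by (fastforce simp: clash_family_def pair_graph_iff)
qed simp_all

text \<open>An embedding sends distinct copies to distinct copies, and sets with disjoint images are
  disjoint.\<close>

lemma scattered_emb:
  assumes "pair_graph H" "pair_graph G" "pair_graph K" "emb h G K" "scattered c H K"
  shows "scattered c H G"
  unfolding scattered_def
proof (intro ballI impI)
  fix A B assume AB: "A \<in> copies H G" "B \<in> copies H G" "A \<noteq> B"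
  have inj: "inj_on h (pverts G)" using assms(4) by (simp add: emb_def)
  have "gimage h A \<noteq> gimage h B"
    using inj_onD[OF inj_on_gimage_copies[OF assms(2) inj]] AB by blast
  moreover have "gimage h A \<in> copies H K" "gimage h B \<in> copies H K"
    using gimage_copies[OF assms(1-4)] AB by auto
  ultimately have "c \<and> h ` pverts A \<inter> h ` pverts B = {}"
    using assms(5) by (fastforce simp: scattered_def)
  then show "c \<and> pverts A \<inter> pverts B = {}" by blast
qed

text \<open>If two copies clash in \<open>G\<close>, their union is a clashing graph of bounded
  order inside \<open>G\<close>. Conversely, a member of the family inside a scattered
  \<open>G\<close> would itself be scattered.\<close>

lemma family_free_clash_family:
  assumes "pair_graph H" "pair_graph G"
  shows "family_free (clash_family c H) G \<longleftrightarrow> scattered c H G"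
proof -
  have pg: "\<forall>F\<in>clash_family c H. pair_graph F" by (simp add: clash_family_def)
  have "\<exists>F\<in>clash_family c H. \<exists>f. emb f F G" if ns: "\<not> scattered c H G"
  proof -
    obtain K L where KL: "K \<in> copies H G" "L \<in> copies H G" "K \<noteq> L"
      "\<not> (c \<and> pverts K \<inter> pverts L = {})"
      using ns unfolding scattered_def by blast
    then obtain f g where f: "emb f H G" "K = gimage f H" and g: "emb g H G" "L = gimage g H"
      unfolding copies_eq_gimage[OF assms] by blast
    have fg: "gimage f H \<noteq> gimage g H" "\<not> (c \<and> f ` pverts H \<inter> g ` pverts H = {})"
      using KL(3,4) f(2) g(2) by simp_all
    define S where "S = \<lparr>pverts = f ` pverts H \<union> g ` pverts H,
      parcs = map_prod f f ` parcs H \<union> map_prod g g ` parcs H\<rparr>"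
    have "pair_graph (gimage f H)" "pair_graph (gimage g H)"
      using f g pair_graph_gimage[OF assms(1)] emb_inj by blast+
    then have "finite (pverts S)" "parcs S \<subseteq> pverts S \<times> pverts S" "irrefl (parcs S)" "sym (parcs S)"
      unfolding pair_graph_iff S_def by (auto simp: irrefl_def intro: sym_Un)
    then have S: "pair_graph S" unfolding pair_graph_iff by blast
    have fS: "emb f H S" "emb g H S"
      using f(1) g(1) unfolding emb_def S_def by simp_all
    have SG: "emb id S G"
      using f(1) g(1) unfolding emb_def S_def prod.map_id0 by simp
    \<comment> \<open>Numbering the vertices consecutively from \<open>0\<close> moves the union
      into the vertex range of the family.\<close>
    obtain h :: "'b \<Rightarrow> nat" where h: "inj_on h (pverts S)" "h ` pverts S = {0..<card (pverts S)}"
      using ex_bij_betw_finite_nat[OF pair_graph_finite_verts[OF S]] by (auto simp: bij_betw_def)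
    let ?F = "gimage h S"
    have F: "pair_graph ?F" by (rule pair_graph_gimage[OF S h(1)])
    have "card (pverts S) \<le> card (f ` pverts H) + card (g ` pverts H)"
      by (simp add: S_def card_Un_le)
    also have "\<dots> \<le> 2 * card (pverts H)"
      using card_image_le[OF pair_graph_finite_verts[OF assms(1)], of f]
        card_image_le[OF pair_graph_finite_verts[OF assms(1)], of g] by linarith
    finally have "pverts ?F \<subseteq> {..<2 * card (pverts H)}"
      using h(2) by auto
    moreover have "\<not> scattered c H S"
    proof -
      have "gimage f H \<in> copies H S" "gimage g H \<in> copies H S"
        using fS unfolding copies_eq_gimage[OF assms(1) S] by blast+
      with fg show ?thesis unfolding scattered_def by (metis gimage_simps(1))
    qed
    then have "\<not> scattered c H ?F"
      using scattered_emb[OF assms(1) S F emb_gimage[OF h(1)]] by blast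
    ultimately have "?F \<in> clash_family c H"
      using F by (simp add: clash_family_def)
    moreover have "emb (id \<circ> the_inv_into (pverts S) h) ?F G"
      by (rule emb_comp[OF emb_inv_gimage[OF S h(1)] SG])
    ultimately show ?thesis by blast
  qed
  moreover have "\<not> emb f F G" if "scattered c H G" "F \<in> clash_family c H" for f F
    using scattered_emb[OF assms(1) _ assms(2) _ that(1)] that(2) by (auto simp: clash_family_def)
  ultimately show ?thesis
    using family_free_iff_no_emb[OF pg assms(2)] by blast
qed

section \<open>Sunflowers of copies\<close>

text \<open>Petals share the kernel \<open>C\<close> (index \<open>0\<close>). The set \<open>W\<close> adds isolated vertices, and an empty kernel
  gives disjoint unions of copies.\<close>

definition petal :: "'a set \<Rightarrow> nat \<Rightarrow> 'a \<Rightarrow> 'a \<times> nat" where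
  "petal C i x = (x, if x \<in> C then 0 else i)"

definition sunflower ::
    "'a pair_pre_digraph \<Rightarrow> 'a set \<Rightarrow> nat \<Rightarrow> ('a \<times> nat) set \<Rightarrow> ('a \<times> nat) pair_pre_digraph" where
  "sunflower H C t W =
    \<lparr>pverts = (\<Union>i<t. petal C i ` pverts H) \<union> W,
     parcs = (\<Union>i<t. map_prod (petal C i) (petal C i) ` parcs H)\<rparr>"

lemma sunflower_simps [simp]:
  "pverts (sunflower H C t W) = (\<Union>i<t. petal C i ` pverts H) \<union> W"
  "parcs (sunflower H C t W) = (\<Union>i<t. map_prod (petal C i) (petal C i) ` parcs H)"
  by (simp_all add: sunflower_def)

lemma petal_empty [simp]: "petal {} i x = (x, i)"
  by (simp add: petal_def)

lemma inj_on_petal: "inj_on (petal C i) A"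
  by (auto simp: petal_def intro: inj_onI)

lemma pair_graph_sunflower:
  assumes "pair_graph H" "finite W"
  shows "pair_graph (sunflower H C t W)"
proof -
  have p: "pair_graph (gimage (petal C i) H)" for i
    by (rule pair_graph_gimage[OF assms(1) inj_on_petal])
  show ?thesis
    unfolding pair_graph_iff
  proof (intro conjI)
    show "finite (pverts (sunflower H C t W))"
      using assms by (simp add: pair_graph_finite_verts)
    show "parcs (sunflower H C t W) \<subseteq> pverts (sunflower H C t W) \<times> pverts (sunflower H C t W)"
    proof -
      have "map_prod (petal C i) (petal C i) ` parcs H \<subseteq> petal C i ` pverts H \<times> petal C i ` pverts H" for i
        using pair_graph_arcs_subset[OF p[of i]] by simp
      then show ?thesis unfolding sunflower_simps by blast
    qed
    have "sym (\<Union>i<t. parcs (gimage (petal C i) H))"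
      using p by (intro sym_UNION) (simp add: pair_graph_iff)
    then show "sym (parcs (sunflower H C t W))" by simp
    have "(a, a) \<notin> parcs (gimage (petal C i) H)" for a i
      using p[of i] unfolding pair_graph_iff irrefl_def by blast
    then show "irrefl (parcs (sunflower H C t W))" by (simp add: irrefl_def)
  qed
qed

lemma emb_petal: "i < t \<Longrightarrow> emb (petal C i) H (sunflower H C t W)"
  using inj_on_petal unfolding emb_def sunflower_simps by blast

text \<open>A vertex outside the kernel carries the number of its petal, so distinct petals are
  distinct copies.\<close>

lemma card_copies_sunflower_ge:
  assumes "pair_graph H" "finite W" "\<not> pverts H \<subseteq> C"
  shows "t \<le> card (copies H (sunflower H C t W))"
proof -
  let ?G = "sunflower H C t W"
  have G: "pair_graph ?G" by (rule pair_graph_sunflower[OF assms(1,2)])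
  obtain x where x: "x \<in> pverts H" "x \<notin> C" using assms(3) by blast
  have "i = j" if "petal C i ` pverts H = petal C j ` pverts H" for i j
  proof -
    have "(x, i) \<in> petal C j ` pverts H"
      using that x by (force simp: petal_def)
    then show ?thesis using x by (auto simp: petal_def)
  qed
  then have "inj_on (\<lambda>i. gimage (petal C i) H) {..<t}"
    by (auto simp: gimage_eq_iff intro: inj_onI)
  moreover have "(\<lambda>i. gimage (petal C i) H) ` {..<t} \<subseteq> copies H ?G"
    using emb_petal copies_eq_gimage[OF assms(1) G] by blast
  ultimately have "card {..<t} \<le> card (copies H ?G)"
    by (rule card_inj_on_le[OF _ _ finite_copies[OF G]])
  then show ?thesis by simp
qed

section \<open>The exponent 0\<close>

text \<open>The extremal number is exactly \<open>1\<close> from \<open>n = ?v\<close> on. The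
  witness is one petal with padding: without isolated vertices a copy is determined by its arcs, and
  it has to use all arcs of the witness.\<close>

lemma realizable_0:
  assumes "pair_graph H" "\<forall>v. \<not> isolated_vertex H v"
  shows "realizable H 0"
proof -
  let ?v = "card (pverts H)" and ?\<F> = "clash_family False H"
  have pg: "\<forall>F\<in>?\<F>. pair_graph F" by (simp add: clash_family_def)
  have "ex_number n H ?\<F> = 1" if n: "?v \<le> n" for n
  proof (rule antisym)
    show "ex_number n H ?\<F> \<le> 1"
    proof (rule ex_number_le)
      fix G assume "G \<in> free_graphs n ?\<F>"
      then have "pair_graph G" "scattered False H G"
        using family_free_clash_family[OF assms(1)] by (auto simp: free_graphs_def)
      then show "card (copies H G) \<le> 1"
        by (auto simp: scattered_def card_le_Suc0_iff_eq finite_copies)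
    qed
    \<comment> \<open>These are \<open>n - ?v\<close> padding vertices; their indices start at
      \<open>1\<close>, so they avoid the petal with index \<open>0\<close>.\<close>
    define W where "W = {undefined :: 'a} \<times> {1..<1 + (n - ?v)}"
    let ?G = "sunflower H {} 1 W"
    have G: "pair_graph ?G" by (rule pair_graph_sunflower[OF assms(1)]) (simp add: W_def)
    have verts: "pverts H = fst ` parcs H"
      using assms pair_graph_arcs_subset[OF assms(1)] by (force simp: isolated_vertex_def)
    let ?a = "map_prod (petal {} 0) (petal {} 0) ` parcs H"
    have "K = \<lparr>pverts = fst ` ?a, parcs = ?a\<rparr>" if K: "K \<in> copies H ?G" for K
    proof -
      obtain f where f: "emb f H ?G" "K = gimage f H"
        using K unfolding copies_eq_gimage[OF assms(1) G] by blast
      have "map_prod f f ` parcs H = ?a"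
      proof (rule card_subset_eq)
        show "finite ?a" using assms(1) by (simp add: pair_graph_finite_arcs)
        show "map_prod f f ` parcs H \<subseteq> ?a" using f(1) by (simp add: emb_def lessThan_Suc)
        show "card (map_prod f f ` parcs H) = card ?a"
          using inj_on_map_prod_arcs[OF assms(1) emb_inj[OF f(1)]]
            inj_on_map_prod_arcs[OF assms(1) inj_on_petal, THEN card_image]
          by (simp only: card_image)
      qed
      moreover have "f ` pverts H = fst ` map_prod f f ` parcs H"
        by (simp add: verts image_image)
      ultimately show ?thesis by (simp add: f(2) gimage_def)
    qed
    then have "scattered False H ?G" by (auto simp: scattered_def)
    then have "card (copies H ?G) \<le> ex_number (card (pverts ?G)) H ?\<F>"
      using card_copies_le_ex_number[OF pg assms(1) G] family_free_clash_family[OF assms(1) G] by blast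
    moreover have "card (pverts ?G) = n"
    proof -
      have "card (pverts ?G) = card (petal {} 0 ` pverts H) + card W"
        unfolding sunflower_simps
        by (subst card_Un_disjoint) (auto simp: W_def pair_graph_finite_verts[OF assms(1)] lessThan_Suc)
      also have "\<dots> = n"
        using n unfolding W_def card_image[OF inj_on_petal] by (simp add: card_cartesian_product)
      finally show ?thesis .
    qed
    moreover have "0 < card (copies H ?G)"
    proof -
      have "gimage (petal {} 0) H \<in> copies H ?G"
        using emb_petal[OF zero_less_one] unfolding copies_eq_gimage[OF assms(1) G] by blast
      then show ?thesis using finite_copies[OF G] by (metis card_gt_0_iff empty_iff)
    qed
    ultimately show "1 \<le> ex_number n H ?\<F>" by simp
  qed
  \<comment> \<open>The threshold \<open>max 1 ?v\<close> excludes \<open>n = 0\<close>, where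
    \<open>0 powr 0\<close> is \<open>0\<close> and not \<open>1\<close>.\<close>
  then have "\<forall>\<^sub>F n in sequentially. real (ex_number n H ?\<F>) = real n powr real_of_rat 0"
    by (intro eventually_sequentiallyI[of "max 1 ?v"]) auto
  then have "(\<lambda>n. real (ex_number n H ?\<F>)) \<in> \<Theta>(\<lambda>n. real n powr real_of_rat 0)"
    by (rule bigthetaI_cong)
  then show ?thesis
    unfolding realizable_def using pg finite_clash_family by (intro conjI exI[of _ ?\<F>]) auto
qed

section \<open>The exponent 1\<close>

text \<open>Connectedness is reachability in the symmetric closure, so the value is carried along a
  path whose arcs may be traversed in either direction.\<close>

lemma connected_imp_constant:
  assumes "Digraph_Component.connected (with_proj H)" "\<And>x y. (x, y) \<in> parcs H \<Longrightarrow> p x = p y"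
    "x \<in> pverts H" "y \<in> pverts H"
  shows "p x = p y"
proof -
  have "x \<rightarrow>\<^sup>*\<^bsub>with_proj (mk_symmetric (with_proj H))\<^esub> y"
    using assms by (simp add: Digraph_Component.connected_def strongly_connected_def)
  then have "(x, y) \<in> (parcs (mk_symmetric (with_proj H)))\<^sup>*"
    using reachable_rtranclI by fastforce
  then show ?thesis
  proof induction
    case (step y z)
    then have "(y, z) \<in> parcs H \<or> (z, y) \<in> parcs H"
      by (auto simp: parcs_mk_symmetric)
    with step assms(2) show ?case by metis
  qed simp
qed

text \<open>By connectivity a copy lies within one petal or is a single vertex of \<open>J\<close>, and it fills it.\<close>

lemma copy_in_disjoint_union:
  fixes H :: "'a pair_pre_digraph"
  assumes H: "pair_graph H" "Digraph_Component.connected (with_proj H)"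
    and J: "finite J" "J \<inter> {..<t} = {}"
    and G: "G = sunflower H {} t ({a} \<times> J)"
    and K: "K \<in> copies H G" "q \<in> pverts K"
  shows "K = \<lparr>pverts = {p \<in> pverts G. snd p = snd q}, parcs = {e \<in> parcs G. snd (fst e) = snd q}\<rparr>"
proof -
  let ?i = "snd q"
  let ?X = "{p \<in> pverts G. snd p = ?i}" and ?Y = "{e \<in> parcs G. snd (fst e) = ?i}"
  have pG: "pair_graph G" unfolding G using H(1) J(1) by (intro pair_graph_sunflower) auto
  obtain f where f: "emb f H G" "K = gimage f H"
    using K(1) unfolding copies_eq_gimage[OF H(1) pG] by blast
  obtain x0 where x0: "x0 \<in> pverts H" "q = f x0" using K(2) f(2) by auto
  have arc: "snd (fst e) = snd (snd e)" if "e \<in> parcs G" for e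
    using that by (auto simp: G)
  have "snd (f x) = snd (f y)" if "(x, y) \<in> parcs H" for x y
  proof -
    have "map_prod f f (x, y) \<in> parcs G" using f(1) that unfolding emb_def by blast
    from arc[OF this] show ?thesis by simp
  qed
  then have i: "snd (f x) = ?i" if "x \<in> pverts H" for x
    using connected_imp_constant[OF H(2), of "\<lambda>x. snd (f x)"] that x0 by blast
  have "f ` pverts H = ?X"
  proof (rule card_seteq)
    show "finite ?X" using pair_graph_finite_verts[OF pG] by simp
    show "f ` pverts H \<subseteq> ?X" using f(1) i by (auto simp: emb_def image_subset_iff)
    \<comment> \<open>A petal index carries as many vertices as \<open>H\<close>; a padding index
      carries at most one, and \<open>H\<close> has the vertex \<open>x0\<close>.\<close>
    have "card ?X \<le> card (pverts H)"
    proof (cases "?i < t")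
      case True
      then have "?X \<subseteq> (\<lambda>x. (x, ?i)) ` pverts H" using J(2) by (auto simp: G)
      then show ?thesis by (rule surj_card_le[OF pair_graph_finite_verts[OF H(1)]])
    next
      case False
      then have "?X \<subseteq> {(a, ?i)}" by (auto simp: G)
      then have "card ?X \<le> 1" using card_mono[of "{(a, ?i)}" ?X] by simp
      also have "1 \<le> card (pverts H)"
        using x0(1) pair_graph_finite_verts[OF H(1)] by (simp add: Suc_le_eq card_gt_0_iff) blast
      finally show ?thesis .
    qed
    then show "card ?X \<le> card (f ` pverts H)" by (simp add: card_image[OF emb_inj[OF f(1)]])
  qed
  moreover have "map_prod f f ` parcs H = ?Y"
  proof (rule card_seteq)
    show "finite ?Y" using pair_graph_finite_arcs[OF pG] by simp
    show "map_prod f f ` parcs H \<subseteq> ?Y"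
    proof
      fix e assume e: "e \<in> map_prod f f ` parcs H"
      then have "snd (fst e) = ?i" using i pair_graph_arcs_subset[OF H(1)] by auto
      moreover have "e \<in> parcs G" using e f(1) unfolding emb_def by blast
      ultimately show "e \<in> ?Y" by simp
    qed
    \<comment> \<open>A padding index carries no arcs, so the inclusion holds for it as
      well.\<close>
    have "?Y \<subseteq> map_prod (petal {} ?i) (petal {} ?i) ` parcs H" by (force simp: G)
    then have "card ?Y \<le> card (parcs H)" by (rule surj_card_le[OF pair_graph_finite_arcs[OF H(1)]])
    then show "card ?Y \<le> card (map_prod f f ` parcs H)"
      by (simp add: card_image[OF inj_on_map_prod_arcs[OF H(1) emb_inj[OF f(1)]]])
  qed
  ultimately show ?thesis by (simp add: f(2) gimage_def)
qed

text \<open>Choosing one vertex from each copy is injective when the copies are disjoint.\<close>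

lemma card_disjoint_copies_le:
  assumes "pair_graph H" "pair_graph G" "pverts H \<noteq> {}" "scattered True H G"
  shows "card (copies H G) \<le> card (pverts G)"
proof (rule card_inj_on_le[OF _ _ pair_graph_finite_verts[OF assms(2)]])
  let ?c = "\<lambda>K. SOME x. x \<in> pverts K"
  have ne: "pverts K \<noteq> {}" if "K \<in> copies H G" for K
    using that assms(3) unfolding copies_eq_gimage[OF assms(1,2)] by auto
  have c: "?c K \<in> pverts K" if "K \<in> copies H G" for K
    using ne[OF that] by (simp add: some_in_eq)
  show "inj_on ?c (copies H G)"
  proof (rule inj_onI, rule ccontr)
    fix K L assume KL: "K \<in> copies H G" "L \<in> copies H G" "?c K = ?c L" "K \<noteq> L"
    then have "pverts K \<inter> pverts L = {}" using assms(4) unfolding scattered_def by blast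
    with c[OF KL(1)] c[OF KL(2)] KL(3) show False by auto
  qed
  show "?c ` copies H G \<subseteq> pverts G"
    using c copies_subset[of H G] by blast
qed

lemma realizable_1:
  fixes H :: "'a pair_pre_digraph"
  assumes H: "pair_graph H" "Digraph_Component.connected (with_proj H)"
  shows "realizable H 1"
proof -
  let ?v = "card (pverts H)" and ?\<F> = "clash_family True H"
  have ne: "pverts H \<noteq> {}"
    using H(2) by (simp add: Digraph_Component.connected_def strongly_connected_def)
  then have v: "1 \<le> ?v"
    using pair_graph_finite_verts[OF H(1)] by (simp add: Suc_le_eq card_gt_0_iff)
  have pg: "\<forall>F\<in>?\<F>. pair_graph F" by (simp add: clash_family_def)
  have upper: "ex_number n H ?\<F> \<le> n" for n
  proof (rule ex_number_le)
    fix G assume "G \<in> free_graphs n ?\<F>"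
    then have "pair_graph G" "scattered True H G" "card (pverts G) = n"
      using family_free_clash_family[OF H(1)] by (auto simp: free_graphs_def)
    then show "card (copies H G) \<le> n"
      using card_disjoint_copies_le[OF H(1) _ ne] by blast
  qed
  have lower: "n div ?v \<le> ex_number n H ?\<F>" for n
  proof -
    define t where "t = n div ?v"
    \<comment> \<open>Indices past the petals: the remainder \<open>n mod ?v\<close> pads the union
      to exactly \<open>n\<close> vertices.\<close>
    define J where "J = {t..<t + n mod ?v}"
    define G where "G = sunflower H {} t ({undefined} \<times> J)"
    have J: "finite J" "J \<inter> {..<t} = {}" by (auto simp: J_def)
    have G: "pair_graph G" unfolding G_def using H(1) J(1) by (intro pair_graph_sunflower) auto
    have "K = L" if KL: "K \<in> copies H G" "L \<in> copies H G" "pverts K \<inter> pverts L \<noteq> {}" for K L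
    proof -
      obtain q where q: "q \<in> pverts K" "q \<in> pverts L" using KL(3) by blast
      show ?thesis
        \<comment> \<open>The description of a copy depends only on the index of one of its
          vertices, so a shared vertex makes the copies equal.\<close>
        by (rule trans[OF copy_in_disjoint_union[OF H J G_def KL(1) q(1)]
              copy_in_disjoint_union[OF H J G_def KL(2) q(2), symmetric]])
    qed
    then have "scattered True H G" unfolding scattered_def by blast
    then have "card (copies H G) \<le> ex_number (card (pverts G)) H ?\<F>"
      using card_copies_le_ex_number[OF pg H(1) G] family_free_clash_family[OF H(1) G] by blast
    moreover have "t \<le> card (copies H G)"
      unfolding G_def using ne J(1) by (intro card_copies_sunflower_ge[OF H(1)]) auto
    moreover have "card (pverts G) = n"
    proof -
      have "pverts G = pverts H \<times> {..<t} \<union> {undefined} \<times> J"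
        by (auto simp: G_def)
      moreover have "card (pverts H \<times> {..<t} \<union> {undefined} \<times> J) = ?v * t + n mod ?v"
        using J pair_graph_finite_verts[OF H(1)]
        by (subst card_Un_disjoint) (auto simp: J_def card_cartesian_product)
      ultimately show ?thesis by (simp add: t_def)
    qed
    ultimately show ?thesis by (simp add: t_def)
  qed
  have "(\<lambda>n. real (ex_number n H ?\<F>)) \<in> \<Theta>(\<lambda>n. real n)"
  proof (rule bigthetaI)
    show "(\<lambda>n. real (ex_number n H ?\<F>)) \<in> O(\<lambda>n. real n)"
      using upper by (intro bigoI[of _ 1]) simp
    \<comment> \<open>Once the quotient \<open>n div ?v\<close> is at least \<open>1\<close>,
      rounding down costs at most a factor 2.\<close>
    show "(\<lambda>n. real (ex_number n H ?\<F>)) \<in> \<Omega>(\<lambda>n. real n)"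
    proof (rule landau_omega.bigI[of "1 / (2 * real ?v)"])
      show "\<forall>\<^sub>F n in sequentially.
          1 / (2 * real ?v) * norm (real n) \<le> norm (real (ex_number n H ?\<F>))"
      proof (rule eventually_sequentiallyI)
        fix n assume n: "?v \<le> n"
        have "n < ?v * (n div ?v) + ?v"
          using mult_div_mod_eq[of ?v n] mod_less_divisor[of ?v n] v by linarith
        moreover have "?v * 1 \<le> ?v * (n div ?v)"
          using n v by (intro mult_le_mono2) (simp add: div_greater_zero_iff Suc_le_eq)
        moreover have "?v * (n div ?v) \<le> ?v * ex_number n H ?\<F>"
          by (rule mult_le_mono2[OF lower])
        ultimately have "n \<le> 2 * (?v * ex_number n H ?\<F>)" by linarith
        then have "real n \<le> real (2 * (?v * ex_number n H ?\<F>))" by (rule of_nat_mono)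
        then show "1 / (2 * real ?v) * norm (real n) \<le> norm (real (ex_number n H ?\<F>))"
          using v by (simp add: field_simps)
      qed
    qed (use v in simp)
  qed
  then have "(\<lambda>n. real (ex_number n H ?\<F>)) \<in> \<Theta>(\<lambda>n. real n powr real_of_rat 1)"
    by simp
  then show ?thesis
    unfolding realizable_def using pg finite_clash_family v
    by (intro conjI exI[of _ ?\<F>]) auto
qed

section \<open>From many copies to large sunflowers\<close>

text \<open>A sunflower lemma for maps instead of sets, so that the kernel is the same set of
  vertices of \<open>H\<close> in every copy. Induction on the number of points outside the current
  kernel \<open>C\<close>: either \<open>m\<close> maps have disjoint images off \<open>C\<close>,
  or many maps share a value at a further point, which joins the kernel.\<close>

lemma sunflower_maps:
  fixes \<phi> :: "'i \<Rightarrow> 'a \<Rightarrow> 'b"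
  assumes "finite V" "C \<subseteq> V" "finite I" "\<And>i. i \<in> I \<Longrightarrow> inj_on (\<phi> i) V"
    and "\<And>i j x. i \<in> I \<Longrightarrow> j \<in> I \<Longrightarrow> x \<in> C \<Longrightarrow> \<phi> i x = \<phi> j x"
    and "\<And>i j. i \<in> I \<Longrightarrow> j \<in> I \<Longrightarrow> i \<noteq> j \<Longrightarrow> \<exists>x\<in>V. \<phi> i x \<noteq> \<phi> j x"
    and "(m * card V * card V) ^ card (V - C) < card I"
  shows "\<exists>D J. D \<subset> V \<and> J \<subseteq> I \<and> card J = m \<and> (\<forall>i\<in>J. \<forall>j\<in>J. \<forall>x\<in>D. \<phi> i x = \<phi> j x) \<and>
    (\<forall>i\<in>J. \<forall>j\<in>J. i \<noteq> j \<longrightarrow> \<phi> i ` (V - D) \<inter> \<phi> j ` (V - D) = {})"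
  using assms(2-7)
proof (induction "card (V - C)" arbitrary: C I)
  case 0
  have "V - C = {}" using "0.hyps" assms(1) by simp
  then have "C = V" using "0.prems"(1) by blast
  \<comment> \<open>With exponent \<open>0\<close> the bound leaves two indices, whose maps would
    agree on all of \<open>V\<close>.\<close>
  have "\<not> card I \<le> Suc 0" using "0.prems"(6) unfolding "0.hyps"[symmetric] by simp
  then obtain i j where ij: "i \<in> I" "j \<in> I" "i \<noteq> j"
    unfolding card_le_Suc0_iff_eq[OF "0.prems"(2)] by blast
  show ?case
    using "0.prems"(4)[OF ij(1,2)] "0.prems"(5)[OF ij] \<open>C = V\<close> by blast
next
  case (Suc d)
  let ?v = "card V" and ?B = "(m * card V * card V) ^ d"
  have V_C: "V - C \<noteq> {}" using Suc.hyps(2) by force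
  let ?disj = "\<lambda>J. \<forall>i\<in>J. \<forall>j\<in>J. i \<noteq> j \<longrightarrow> \<phi> i ` (V - C) \<inter> \<phi> j ` (V - C) = {}"
  define \<J> where "\<J> = {J. J \<subseteq> I \<and> ?disj J}"
  have "\<J> \<subseteq> Pow I" "{} \<in> \<J>" unfolding \<J>_def by blast+
  then have "finite \<J>" "\<J> \<noteq> {}" using Suc.prems(2) finite_subset by auto
  \<comment> \<open>If this maximal disjoint subfamily has fewer than \<open>m\<close> members,
    every map must hit the small set \<open>X\<close> of their values off \<open>C\<close>.\<close>
  from finite_has_maximal[OF this]
  obtain J where "J \<in> \<J>" and max: "\<And>J'. J' \<in> \<J> \<Longrightarrow> J \<subseteq> J' \<Longrightarrow> J = J'" by blast
  then have J: "J \<subseteq> I" "?disj J" unfolding \<J>_def by blast+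
  show ?case
  proof (cases "m \<le> card J")
    case True
    then obtain J' where J': "J' \<subseteq> J" "card J' = m" by (meson obtain_subset_with_card_n)
    have "C \<subset> V" using V_C Suc.prems(1) by blast
    moreover have "J' \<subseteq> I" using J' J by blast
    moreover have "\<forall>i\<in>J'. \<forall>j\<in>J'. \<forall>x\<in>C. \<phi> i x = \<phi> j x"
      using \<open>J' \<subseteq> I\<close> Suc.prems(4) by blast
    moreover have "?disj J'" using J(2) J'(1) by blast
    ultimately show ?thesis using J'(2) by blast
  next
    case False
    define X where "X = (\<Union>j\<in>J. \<phi> j ` (V - C))"
    have finJ: "finite J" using J(1) Suc.prems(2) by (rule finite_subset)
    have finX: "finite X" using finJ assms(1) by (simp add: X_def)
    have vC: "card (V - C) \<le> ?v" using assms(1) by (simp add: card_mono)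
    have "card X \<le> (\<Sum>j\<in>J. card (\<phi> j ` (V - C)))" unfolding X_def by (rule card_UN_le[OF finJ])
    also have "\<dots> \<le> (\<Sum>j\<in>J. ?v)"
      by (rule sum_mono, rule order_trans[OF card_image_le vC]) (simp add: assms(1))
    also have "\<dots> \<le> m * ?v" using False by simp
    finally have cX: "card X \<le> m * ?v" .
    have hit: "\<exists>x\<in>V - C. \<phi> i x \<in> X" if i: "i \<in> I" for i
    proof (rule ccontr)
      assume no: "\<not> (\<exists>x\<in>V - C. \<phi> i x \<in> X)"
      then have away: "\<phi> i ` (V - C) \<inter> \<phi> j ` (V - C) = {}" if "j \<in> J" for j
        using that unfolding X_def by blast
      have "i \<notin> J" using away V_C by blast
      moreover have "?disj (insert i J)"
        using away J(2) by (auto simp: Int_commute)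
      moreover have "insert i J \<subseteq> I" using i J(1) by blast
      ultimately show False using max[of "insert i J"] unfolding \<J>_def by blast
    qed
    \<comment> \<open>Pigeonhole over pairs of a point and its value: there are at most
      \<open>?v * (m * ?v)\<close> of them, which is the base of the power in the
      hypothesis.\<close>
    have "\<exists>p\<in>(V - C) \<times> X. ?B < card {i \<in> I. \<phi> i (fst p) = snd p}"
    proof (rule ccontr)
      assume "\<not> ?thesis"
      then have le: "card {i \<in> I. \<phi> i (fst p) = snd p} \<le> ?B" if "p \<in> (V - C) \<times> X" for p
        using that by (meson not_le)
      have fin: "finite ((V - C) \<times> X)" using assms(1) finX by simp
      have "I \<subseteq> (\<Union>p\<in>(V - C) \<times> X. {i \<in> I. \<phi> i (fst p) = snd p})"
        using hit by fastforce
      then have "card I \<le> card (\<Union>p\<in>(V - C) \<times> X. {i \<in> I. \<phi> i (fst p) = snd p})"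
        using fin Suc.prems(2) by (intro card_mono finite_UN_I) simp_all
      also have "\<dots> \<le> (\<Sum>p\<in>(V - C) \<times> X. card {i \<in> I. \<phi> i (fst p) = snd p})"
        by (rule card_UN_le[OF fin])
      also have "\<dots> \<le> (\<Sum>p\<in>(V - C) \<times> X. ?B)" by (rule sum_mono[OF le])
      also have "\<dots> = card (V - C) * card X * ?B" by (simp add: card_cartesian_product)
      also have "\<dots> \<le> ?v * (m * ?v) * ?B" using vC cX by (intro mult_le_mono) simp_all
      also have "\<dots> = (m * ?v * ?v) ^ card (V - C)" using Suc.hyps(2)[symmetric] by simp
      finally show False using Suc.prems(6) by simp
    qed
    then obtain a y where a: "a \<in> V - C" and B: "?B < card {i \<in> I. \<phi> i a = y}" by auto
    let ?I = "{i \<in> I. \<phi> i a = y}"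
    have d: "d = card (V - insert a C)"
      unfolding Diff_insert[of V a C] card_Diff_singleton[OF a] Suc.hyps(2)[symmetric] by simp
    have "\<exists>D J. D \<subset> V \<and> J \<subseteq> ?I \<and> card J = m \<and> (\<forall>i\<in>J. \<forall>j\<in>J. \<forall>x\<in>D. \<phi> i x = \<phi> j x) \<and>
      (\<forall>i\<in>J. \<forall>j\<in>J. i \<noteq> j \<longrightarrow> \<phi> i ` (V - D) \<inter> \<phi> j ` (V - D) = {})"
    proof (rule Suc.hyps(1)[OF d])
      show "insert a C \<subseteq> V" using a Suc.prems(1) by blast
      show "finite ?I" using Suc.prems(2) by simp
      show "inj_on (\<phi> i) V" if "i \<in> ?I" for i using that Suc.prems(3) by simp
      show "\<phi> i x = \<phi> j x" if "i \<in> ?I" "j \<in> ?I" "x \<in> insert a C" for i j x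
        using that Suc.prems(4)[of i j x] by auto
      show "\<exists>x\<in>V. \<phi> i x \<noteq> \<phi> j x" if "i \<in> ?I" "j \<in> ?I" "i \<noteq> j" for i j
        using that Suc.prems(5) by simp
      show "(m * ?v * ?v) ^ card (V - insert a C) < card ?I" using B d by simp
    qed
    then obtain D J where "D \<subset> V" "J \<subseteq> ?I" "card J = m"
      "\<forall>i\<in>J. \<forall>j\<in>J. \<forall>x\<in>D. \<phi> i x = \<phi> j x"
      "\<forall>i\<in>J. \<forall>j\<in>J. i \<noteq> j \<longrightarrow> \<phi> i ` (V - D) \<inter> \<phi> j ` (V - D) = {}" by blast
    moreover from this(2) have "J \<subseteq> I" by blast
    ultimately show ?thesis by blast
  qed
qed

text \<open>A forbidden graph has at most \<open>m\<close> vertices, so it meets at most \<open>m\<close> petals of an arbitrarily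
  large sunflower, and these can be mapped to petals of the given one.\<close>

lemma family_free_sunflower:
  assumes pg: "\<forall>F\<in>\<F>. pair_graph F" "\<forall>F\<in>\<F>. card (pverts F) \<le> m"
    and H: "pair_graph H" and G: "pair_graph G" "family_free \<F> G"
    and J: "finite J" "card J = m" "\<And>j. j \<in> J \<Longrightarrow> emb (\<phi> j) H G"
    and agree: "\<And>i j x. i \<in> J \<Longrightarrow> j \<in> J \<Longrightarrow> x \<in> D \<Longrightarrow> \<phi> i x = \<phi> j x"
    and disj: "\<And>i j. i \<in> J \<Longrightarrow> j \<in> J \<Longrightarrow> i \<noteq> j \<Longrightarrow>
      \<phi> i ` (pverts H - D) \<inter> \<phi> j ` (pverts H - D) = {}"
  shows "family_free \<F> (sunflower H D t {})"
proof -
  let ?S = "sunflower H D t {}"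
  have S: "pair_graph ?S" by (rule pair_graph_sunflower[OF H]) simp
  have False if F: "F \<in> \<F>" and f: "emb f F ?S" for F f
  proof -
    have pF: "pair_graph F" using pg(1) F by blast
    \<comment> \<open>Indices of the petals that \<open>F\<close> meets; kernel vertices contribute
      \<open>0\<close>.\<close>
    define A where "A = snd ` f ` pverts F"
    have finF: "finite (pverts F)" by (rule pair_graph_finite_verts[OF pF])
    then have finA: "finite A" by (simp add: A_def)
    have "card A \<le> card (pverts F)"
      unfolding A_def image_image by (rule card_image_le[OF finF])
    also have "\<dots> \<le> card J" using pg(2) F J(2) by blast
    finally obtain \<rho> where \<rho>: "\<rho> ` A \<subseteq> J" "inj_on \<rho> A"
      using card_le_inj[OF finA J(1)] by blast
    \<comment> \<open>Petal \<open>k\<close> of the large sunflower is sent to the petal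
      \<open>\<rho> k\<close> inside \<open>G\<close>.\<close>
    define g where "g p = \<phi> (\<rho> (snd p)) (fst p)" for p
    let ?U = "f ` pverts F"
    have U: "snd p \<in> A" "fst p \<in> pverts H" "fst p \<in> D \<Longrightarrow> snd p = 0" if "p \<in> ?U" for p
    proof -
      show "snd p \<in> A" using that by (auto simp: A_def)
      have "p \<in> pverts ?S" using that f unfolding emb_def by blast
      then show "fst p \<in> pverts H" "fst p \<in> D \<Longrightarrow> snd p = 0" by (auto simp: petal_def)
    qed
    \<comment> \<open>For a kernel vertex \<open>k\<close> need not be the stored index
      \<open>0\<close>, but all \<open>\<phi> j\<close> agree there.\<close>
    have g_petal: "g p = \<phi> j (fst p)" if "p \<in> ?U" "p = petal D k x" "k \<in> A" "j = \<rho> k" for p j k x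
    proof (cases "x \<in> D")
      case True
      then have "\<rho> (snd p) \<in> J" "j \<in> J" "fst p \<in> D"
        using U(1)[OF that(1)] \<rho>(1) that by (auto simp: petal_def)
      then show ?thesis unfolding g_def by (rule agree)
    next
      case False
      then show ?thesis using that by (simp add: g_def petal_def)
    qed
    have inj_g: "inj_on g ?U"
    proof (rule inj_onI)
      fix p q assume p: "p \<in> ?U" and q: "q \<in> ?U" and eq: "g p = g q"
      have P: "\<rho> (snd p) \<in> J" "\<rho> (snd q) \<in> J" using U(1) p q \<rho>(1) by blast+
      have inj: "inj_on (\<phi> j) (pverts H)" if "j \<in> J" for j by (rule emb_inj[OF J(3)[OF that]])
      show "p = q"
      proof (cases "snd p = snd q")
        case True
        then show ?thesis
          using inj_onD[OF inj[OF P(1)], of "fst p" "fst q"] eq U(2)[OF p] U(2)[OF q]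
          by (simp add: g_def prod_eq_iff)
      next
        case False
        then have ne: "\<rho> (snd p) \<noteq> \<rho> (snd q)" using inj_onD[OF \<rho>(2) _ U(1)[OF p] U(1)[OF q]] by blast
        \<comment> \<open>Values from two different petals of \<open>G\<close> can collide only if a
          kernel vertex is involved; reading both through one \<open>\<phi> j\<close> then gives the
          same vertex of \<open>H\<close>.\<close>
        have "fst p \<in> D \<or> fst q \<in> D"
        proof (rule ccontr)
          assume "\<not> ?thesis"
          then have "g p \<in> \<phi> (\<rho> (snd p)) ` (pverts H - D)" "g q \<in> \<phi> (\<rho> (snd q)) ` (pverts H - D)"
            using U(2) p q by (auto simp: g_def)
          with disj[OF P ne] eq show False by auto
        qed
        then have "fst p = fst q"
        proof
          assume "fst p \<in> D"
          then have "g p = \<phi> (\<rho> (snd q)) (fst p)" unfolding g_def by (rule agree[OF P])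
          then show ?thesis
            using inj_onD[OF inj[OF P(2)], of "fst p" "fst q"] eq U(2)[OF p] U(2)[OF q]
            by (simp add: g_def)
        next
          assume "fst q \<in> D"
          then have "g q = \<phi> (\<rho> (snd p)) (fst q)" unfolding g_def by (rule agree[OF P(2,1)])
          then show ?thesis
            using inj_onD[OF inj[OF P(1)], of "fst p" "fst q"] eq U(2)[OF p] U(2)[OF q]
            by (simp add: g_def)
        qed
        with \<open>fst p \<in> D \<or> fst q \<in> D\<close> have "snd p = 0" "snd q = 0" using U(3) p q by auto
        with False show ?thesis by simp
      qed
    qed
    have "emb (g \<circ> f) F G"
      unfolding emb_def
    proof (intro conjI)
      show "inj_on (g \<circ> f) (pverts F)" by (rule comp_inj_on[OF emb_inj[OF f] inj_g])
      show "(g \<circ> f) ` pverts F \<subseteq> pverts G"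
      proof clarify
        fix x assume "x \<in> pverts F"
        then have "f x \<in> ?U" by blast
        then have "\<rho> (snd (f x)) \<in> J" "fst (f x) \<in> pverts H" using U \<rho>(1) by blast+
        then show "(g \<circ> f) x \<in> pverts G" using J(3) by (auto simp: g_def emb_def)
      qed
      show "map_prod (g \<circ> f) (g \<circ> f) ` parcs F \<subseteq> parcs G"
      proof (rule image_subsetI)
        fix e assume "e \<in> parcs F"
        then obtain x y where e: "e = (x, y)" and xy: "(x, y) \<in> parcs F" by (cases e) simp
        then have xyU: "f x \<in> ?U" "f y \<in> ?U" using pair_graph_arcs_subset[OF pF] by auto
        have "map_prod f f (x, y) \<in> parcs ?S" using xy f unfolding emb_def by blast
        then obtain k a b where ab: "(a, b) \<in> parcs H" "f x = petal D k a" "f y = petal D k b"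
          by auto
        \<comment> \<open>An arc inside the kernel may come from a petal outside \<open>A\<close>;
          it is then read as an arc of petal \<open>0\<close>, an index that its ends put into
          \<open>A\<close>.\<close>
        obtain k' where k': "k' \<in> A" "f x = petal D k' a" "f y = petal D k' b"
        proof (cases "a \<in> D \<and> b \<in> D")
          case True
          then show ?thesis using that[of 0] U(1)[OF xyU(1)] ab by (auto simp: petal_def)
        next
          case False
          then have "k \<in> A" using U(1)[OF xyU(1)] U(1)[OF xyU(2)] ab by (auto simp: petal_def)
          then show ?thesis using that ab by blast
        qed
        have "g (f x) = \<phi> (\<rho> k') a" "g (f y) = \<phi> (\<rho> k') b"
          using g_petal[OF xyU(1) k'(2,1) refl] g_petal[OF xyU(2) k'(3,1) refl] k'(2,3)
          by (simp_all add: petal_def)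
        moreover have "emb (\<phi> (\<rho> k')) H G" using J(3) \<rho>(1) k'(1) by blast
        then have "map_prod (\<phi> (\<rho> k')) (\<phi> (\<rho> k')) (a, b) \<in> parcs G"
          using ab(1) unfolding emb_def by blast
        ultimately show "map_prod (g \<circ> f) (g \<circ> f) e \<in> parcs G" by (simp add: e)
      qed
    qed
    then show False using G(2) F family_free_iff_no_emb[OF pg(1) G(1)] by blast
  qed
  then show ?thesis using family_free_iff_no_emb[OF pg(1) S] by blast
qed

text \<open>One value above a constant forces linear growth along a sequence of orders. The order
  \<open>k\<close> is that of a free sunflower with \<open>t\<close> petals.\<close>

lemma ex_number_linear_if_large:
  assumes pg: "\<forall>F\<in>\<F>. pair_graph F" "\<forall>F\<in>\<F>. card (pverts F) \<le> m"
    and H: "pair_graph H"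
    and large: "(m * card (pverts H) * card (pverts H)) ^ card (pverts H) < ex_number n H \<F>"
  shows "\<exists>k. t \<le> k \<and> k \<le> t * card (pverts H) \<and> t \<le> ex_number k H \<F>"
proof -
  let ?V = "pverts H"
  have finV: "finite ?V" by (rule pair_graph_finite_verts[OF H])
  obtain G where "G \<in> free_graphs n \<F>"
    and many: "(m * card ?V * card ?V) ^ card ?V < card (copies H G)"
    using less_ex_numberE[OF large] .
  then have G: "pair_graph G" "family_free \<F> G" by (auto simp: free_graphs_def)
  \<comment> \<open>One embedding is chosen per copy, so the copies themselves index the
    maps.\<close>
  define \<phi> where "\<phi> K = (SOME f. emb f H G \<and> gimage f H = K)" for K
  have \<phi>: "emb (\<phi> K) H G" "gimage (\<phi> K) H = K" if K: "K \<in> copies H G" for K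
  proof -
    have "\<exists>f. emb f H G \<and> gimage f H = K" using K unfolding copies_eq_gimage[OF H G(1)] by blast
    then have "emb (\<phi> K) H G \<and> gimage (\<phi> K) H = K" unfolding \<phi>_def by (rule someI_ex)
    then show "emb (\<phi> K) H G" "gimage (\<phi> K) H = K" by blast+
  qed
  \<comment> \<open>The search starts from the empty kernel, hence the exponent
    \<open>card (pverts H)\<close> in the hypothesis.\<close>
  have "\<exists>D J. D \<subset> ?V \<and> J \<subseteq> copies H G \<and> card J = m \<and> (\<forall>i\<in>J. \<forall>j\<in>J. \<forall>x\<in>D. \<phi> i x = \<phi> j x) \<and>
    (\<forall>i\<in>J. \<forall>j\<in>J. i \<noteq> j \<longrightarrow> \<phi> i ` (?V - D) \<inter> \<phi> j ` (?V - D) = {})"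
  proof (rule sunflower_maps[OF finV empty_subsetI finite_copies[OF G(1)]])
    show "inj_on (\<phi> K) ?V" if "K \<in> copies H G" for K by (rule emb_inj[OF \<phi>(1)[OF that]])
    show "\<exists>x\<in>?V. \<phi> K x \<noteq> \<phi> L x" if KL: "K \<in> copies H G" "L \<in> copies H G" "K \<noteq> L" for K L
    proof (rule ccontr)
      assume "\<not> ?thesis"
      then have eq: "\<phi> K x = \<phi> L x" if "x \<in> ?V" for x using that by blast
      have "gimage (\<phi> K) H = gimage (\<phi> L) H"
        unfolding gimage_eq_iff using eq pair_graph_arcs_subset[OF H]
        by (intro conjI image_cong) auto
      then show False using \<phi>(2) KL by simp
    qed
    show "(m * card ?V * card ?V) ^ card (?V - {}) < card (copies H G)" using many by simp
  qed simp
  then obtain D J where D: "D \<subset> ?V" and J: "J \<subseteq> copies H G" "card J = m"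
    and agree: "\<forall>i\<in>J. \<forall>j\<in>J. \<forall>x\<in>D. \<phi> i x = \<phi> j x"
    and disj: "\<forall>i\<in>J. \<forall>j\<in>J. i \<noteq> j \<longrightarrow> \<phi> i ` (?V - D) \<inter> \<phi> j ` (?V - D) = {}"
    by blast
  let ?S = "sunflower H D t {}"
  have S: "pair_graph ?S" by (rule pair_graph_sunflower[OF H]) simp
  have "family_free \<F> ?S"
  proof (rule family_free_sunflower[OF pg H G])
    show "finite J" by (rule finite_subset[OF J(1) finite_copies[OF G(1)]])
    show "card J = m" by (rule J(2))
    show "emb (\<phi> j) H G" if "j \<in> J" for j using that J(1) \<phi>(1) by blast
  qed (use agree disj in blast)+
  then have "card (copies H ?S) \<le> ex_number (card (pverts ?S)) H \<F>"
    by (rule card_copies_le_ex_number[OF pg(1) H S])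
  moreover have "t \<le> card (copies H ?S)"
    using D by (intro card_copies_sunflower_ge[OF H]) auto
  moreover have "t \<le> card (pverts ?S)"
  proof -
    obtain x where x: "x \<in> ?V" "x \<notin> D" using D by blast
    have "(\<lambda>i. (x, i)) ` {..<t} \<subseteq> pverts ?S" using x by (force simp: petal_def)
    then have "card ((\<lambda>i. (x, i)) ` {..<t}) \<le> card (pverts ?S)"
      by (rule card_mono[OF pair_graph_finite_verts[OF S]])
    then show ?thesis by (simp add: card_image inj_on_def)
  qed
  moreover have "card (pverts ?S) \<le> t * card ?V"
  proof -
    have "card (pverts ?S) \<le> (\<Sum>i<t. card (petal D i ` ?V))"
      unfolding sunflower_simps Un_empty_right by (rule card_UN_le) simp
    also have "\<dots> = t * card ?V" by (simp add: card_image[OF inj_on_petal])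
    finally show ?thesis .
  qed
  ultimately show ?thesis by (meson order_trans)
qed

section \<open>Exponents strictly between 0 and 1\<close>

text \<open>A positive exponent pushes the extremal number above \<open>B\<close>, so it is at least
  \<open>k / ?v\<close> for arbitrarily large \<open>k\<close>. An exponent below 1 makes it
  eventually smaller than that.\<close>

lemma not_realizable_between_0_1:
  assumes H: "pair_graph H" and r: "0 < r" "r < 1"
  shows "\<not> realizable H r"
proof
  assume "realizable H r"
  then obtain \<F> where \<F>: "finite \<F>" "\<forall>F\<in>\<F>. pair_graph F"
    and theta: "(\<lambda>n. real (ex_number n H \<F>)) \<in> \<Theta>(\<lambda>n. real n powr real_of_rat r)"
    unfolding realizable_def by blast
  let ?s = "real_of_rat r" and ?v = "card (pverts H)"
  obtain m where "\<forall>k\<in>(\<lambda>F. card (pverts F)) ` \<F>. k \<le> m"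
    using \<F>(1) finite_nat_set_iff_bounded_le by blast
  then have m: "\<forall>F\<in>\<F>. card (pverts F) \<le> m" by blast
  define B where "B = (m * ?v * ?v) ^ ?v"
  have s: "0 < ?s" "?s < 1" using r by simp_all
  have at_top: "filterlim real at_top sequentially" by (rule filterlim_real_sequentially)
  obtain n where n: "B < ex_number n H \<F>"
  proof -
    obtain c where c: "c > 0"
      "\<forall>\<^sub>F n in sequentially. c * norm (real n powr ?s) \<le> norm (real (ex_number n H \<F>))"
      using landau_omega.bigE[OF bigthetaD2[OF theta]] .
    have "(\<lambda>n. real n powr 0) \<in> o(\<lambda>n. real n powr ?s)"
      using s(1) by (subst powr_smallo_iff[OF at_top]) simp_all
    \<comment> \<open>The constant is chosen so that the lower bound
      \<open>c * real n powr ?s\<close> eventually reaches \<open>real B + 1\<close>.\<close>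
    from landau_o.smallD[OF this, of "c / (real B + 1)"] c(1)
    have "\<forall>\<^sub>F n in sequentially. norm (real n powr 0) \<le> c / (real B + 1) * norm (real n powr ?s)"
      by (simp add: add_nonneg_pos del: powr_zero_eq_one)
    with c(2) eventually_gt_at_top[of 0]
    have "\<forall>\<^sub>F n in sequentially. B < ex_number n H \<F>"
    proof eventually_elim
      case (elim n)
      then have "real B + 1 \<le> c * real n powr ?s"
        by (simp add: field_simps add_nonneg_pos)
      also have "\<dots> \<le> real (ex_number n H \<F>)" using elim by simp
      finally show ?case by linarith
    qed
    then show thesis using that by (meson eventually_happens trivial_limit_sequentially)
  qed
  obtain C where C: "C > 0"
    "\<forall>\<^sub>F n in sequentially. norm (real (ex_number n H \<F>)) \<le> C * norm (real n powr ?s)"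
    using landau_o.bigE[OF bigthetaD1[OF theta]] .
  have "(\<lambda>n. real n powr ?s) \<in> o(\<lambda>n. real n powr 1)"
    using s(2) by (subst powr_smallo_iff[OF at_top]) simp_all
  \<comment> \<open>The factor 2 gives a strict inequality at the end, and
    \<open>real ?v + 1\<close> keeps the denominator positive even for the null graph.\<close>
  from landau_o.smallD[OF this, of "1 / (2 * C * (real ?v + 1))"] C(1)
  have "\<forall>\<^sub>F n in sequentially.
      norm (real n powr ?s) \<le> 1 / (2 * C * (real ?v + 1)) * norm (real n powr 1)"
    by (simp add: add_nonneg_pos)
  with C(2) eventually_gt_at_top[of 0]
  have "\<forall>\<^sub>F n in sequentially. ex_number n H \<F> * ?v < n"
  proof eventually_elim
    case (elim n)
    have "real (ex_number n H \<F>) \<le> C * real n powr ?s" using elim by simp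
    also have "\<dots> \<le> C * (1 / (2 * C * (real ?v + 1)) * real n)"
      using elim C(1) by (intro mult_left_mono) simp_all
    also have "\<dots> = real n / (2 * (real ?v + 1))" using C(1) by simp
    finally have "real (ex_number n H \<F>) * (real ?v + 1) \<le> real n / 2"
      by (simp add: field_simps add_nonneg_pos)
    then have "real (ex_number n H \<F>) * real ?v \<le> real n / 2"
      by (smt (verit) mult_left_mono of_nat_0_le_iff)
    also have "\<dots> < real n" using elim by simp
    finally show ?case by (metis of_nat_less_iff of_nat_mult)
  qed
  then obtain N where N: "\<And>n. N \<le> n \<Longrightarrow> ex_number n H \<F> * ?v < n"
    unfolding eventually_sequentially by blast
  \<comment> \<open>With \<open>t = N\<close> the contradiction is
    \<open>k \<le> N * ?v \<le> ex_number k H \<F> * ?v < k\<close>.\<close>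
  obtain k where "N \<le> k" "k \<le> N * ?v" "N \<le> ex_number k H \<F>"
    using ex_number_linear_if_large[OF \<F>(2) m H n[unfolded B_def]] by blast
  with N[of k] show False by (meson leD le_trans mult_le_mono1)
qed

theorem proposition2p3:
  fixes H :: "'a pair_pre_digraph"
  assumes "pair_graph H"
  shows "(\<forall>r :: rat. 0 < r \<and> r < 1 \<longrightarrow> \<not> realizable H r)
    \<and> ((\<forall>v. \<not> isolated_vertex H v) \<longrightarrow> realizable H 0)
    \<and> (Digraph_Component.connected (with_proj H) \<longrightarrow> realizable H 1)"
  using not_realizable_between_0_1[OF assms] realizable_0[OF assms] realizable_1[OF assms] by blast

end
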